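(* Let $k\ge2$ and $n_1,\dots,n_k\ge2$ be integers. Then $\Gamma(\mathbb{Z}_{n_1}\times\cdots\times\mathbb{Z}_{n_k})$ is bipartite if and only if $k=2$ and either both $n_1,n_2$ are prime, or one of $n_1,n_2$ is prime and the other equals $4$.
   Context: For a commutative ring $R$ with identity, the zero-divisor graph $\Gamma(R)$ is the simple undirected graph whose vertices are the nonzero zero-divisors of $R$, two distinct vertices $u,v$ being adjacent iff $uv=0$. *)

theory Defs
  imports
    "HOL-Number_Theory.Residues"
    "HOL-Algebra.Chinese_Remainder"
    "Graph_Theory.Pair_Digraph"
begin

definition zero_divisors :: "('a, 'm) ring_scheme \<Rightarrow> 'a set" where
  "zero_divisors R = {a \<in> carrier R. \<exists>b \<in> carrier R. b \<noteq> \<zero>\<^bsub>R\<^esub> \<and> a \<otimes>\<^bsub>R\<^esub> b = \<zero>\<^bsub>R\<^esub>}"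

text \<open>Simple undirected graphs are encoded as symmetric loop-free
  digraphs without parallel arcs: an edge is a pair of opposite arcs.\<close>

definition zero_divisor_graph :: "('a, 'm) ring_scheme \<Rightarrow> 'a pair_pre_digraph" where
  "zero_divisor_graph R =
     (let V = zero_divisors R - {\<zero>\<^bsub>R\<^esub>} in
       \<lparr>pverts = V,
        parcs = {(u, v). u \<in> V \<and> v \<in> V \<and> u \<noteq> v \<and> u \<otimes>\<^bsub>R\<^esub> v = \<zero>\<^bsub>R\<^esub>}\<rparr>)"

lemma zero_divisor_graph_bidirected:
  assumes "cring R"
  shows "pair_bidirected_digraph (zero_divisor_graph R)"
proof -
  interpret cring R by fact
  have "zero_divisors R \<subseteq> carrier R"
    by (auto simp: zero_divisors_def)
  then show ?thesis
    by unfold_locales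
      (auto simp: zero_divisor_graph_def Let_def symmetric_def m_comm subset_iff intro!: symI)
qed

definition bipartite :: "('a, 'b) pre_digraph \<Rightarrow> bool" where
  "bipartite G \<longleftrightarrow>
     (\<exists>U W. verts G = U \<union> W \<and> U \<inter> W = {} \<and> arcs_ends G \<subseteq> U \<times> W \<union> W \<times> U)"

end

theory Submission
  imports Defs
begin

text \<open>A bipartite graph has no triangle. With at least three factors, the unit vectors \<open>e\<^sub>1\<close>, \<open>e\<^sub>2\<close>, \<open>e\<^sub>3\<close>
  form one. With two factors, an edge \<open>u\<close>, \<open>v\<close> in the zero-divisor graph of one factor yields a triangle
  \<open>(u, 0)\<close>, \<open>(v, 0)\<close>, \<open>(0, 1)\<close>, so both graphs must be edgeless; for \<open>\<int>\<^sub>m\<close> this means that \<open>m\<close>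
  is prime or \<open>4\<close>, since a proper factorization \<open>m = d e\<close> gives the edge \<open>d\<close>, \<open>e\<close> if \<open>d \<noteq> e\<close>
  and \<open>d\<close>, \<open>2 d\<close> if \<open>d = e > 2\<close>. Two factors \<open>\<int>\<^sub>4\<close> are excluded by \<open>(2, 0)\<close>, \<open>(0, 2)\<close>, \<open>(2, 2)\<close>.
  Conversely, if one factor is a domain and the graph of the other is edgeless, the vertices are
  separated by whether their coordinate in the domain vanishes.\<close>

section \<open>Edges and two-colourings of zero-divisor graphs\<close>

lemma parcs_zero_divisor_graph_iff:
  assumes "cring R"
  shows "(u, v) \<in> parcs (zero_divisor_graph R) \<longleftrightarrow>
    u \<in> carrier R \<and> v \<in> carrier R \<and> u \<noteq> \<zero>\<^bsub>R\<^esub> \<and> v \<noteq> \<zero>\<^bsub>R\<^esub> \<and> u \<noteq> v \<and> u \<otimes>\<^bsub>R\<^esub> v = \<zero>\<^bsub>R\<^esub>"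
proof -
  interpret cring R by fact
  show ?thesis
    \<comment> \<open>Two nonzero elements with product zero witness each other as zero-divisors, by
      commutativity, so membership in the vertex set needs no separate condition.\<close>
    unfolding zero_divisor_graph_def zero_divisors_def Let_def
    using m_comm by auto
qed

lemma not_bipartite_if_triangle:
  assumes "cring R" and "{x, y, z} \<subseteq> carrier R"
    and "x \<noteq> \<zero>\<^bsub>R\<^esub>" "y \<noteq> \<zero>\<^bsub>R\<^esub>" "z \<noteq> \<zero>\<^bsub>R\<^esub>"
    and "x \<noteq> y" "y \<noteq> z" "x \<noteq> z"
    and "x \<otimes>\<^bsub>R\<^esub> y = \<zero>\<^bsub>R\<^esub>" "y \<otimes>\<^bsub>R\<^esub> z = \<zero>\<^bsub>R\<^esub>" "x \<otimes>\<^bsub>R\<^esub> z = \<zero>\<^bsub>R\<^esub>"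
  shows "\<not> bipartite (with_proj (zero_divisor_graph R))"
proof -
  have "(x, y) \<in> parcs (zero_divisor_graph R)" "(y, z) \<in> parcs (zero_divisor_graph R)"
    "(x, z) \<in> parcs (zero_divisor_graph R)"
    using assms by (simp_all add: parcs_zero_divisor_graph_iff)
  then show ?thesis
    unfolding bipartite_def with_proj_simps by blast
qed

text \<open>The two sides are the vertices that satisfy \<open>P\<close> and those that do not, so
  only the edges remain to be checked.\<close>

lemma bipartite_zero_divisor_graphI:
  assumes "cring R"
    and "\<And>u v. (u, v) \<in> parcs (zero_divisor_graph R) \<Longrightarrow> P u \<longleftrightarrow> \<not> P v"
  shows "bipartite (with_proj (zero_divisor_graph R))"
proof -
  interpret pair_bidirected_digraph "zero_divisor_graph R"
    using assms(1) by (rule zero_divisor_graph_bidirected)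
  let ?V = "pverts (zero_divisor_graph R)"
  show ?thesis
    unfolding bipartite_def with_proj_simps
  proof (intro exI conjI)
    show "?V = {v \<in> ?V. P v} \<union> {v \<in> ?V. \<not> P v}" "{v \<in> ?V. P v} \<inter> {v \<in> ?V. \<not> P v} = {}"
      by auto
    show "parcs (zero_divisor_graph R) \<subseteq>
        {v \<in> ?V. P v} \<times> {v \<in> ?V. \<not> P v} \<union> {v \<in> ?V. \<not> P v} \<times> {v \<in> ?V. P v}"
      using assms(2) in_arcsD1 in_arcsD2 by fastforce
  qed
qed

section \<open>Arithmetic in products of lists of rings\<close>

lemma RDirProd_list_mult_Cons:
  assumes "a \<in> carrier R" "b \<in> carrier R" "as \<in> carrier (RDirProd_list Rs)"
    "bs \<in> carrier (RDirProd_list Rs)"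
  shows "(a # as) \<otimes>\<^bsub>RDirProd_list (R # Rs)\<^esub> (b # bs) =
    (a \<otimes>\<^bsub>R\<^esub> b) # (as \<otimes>\<^bsub>RDirProd_list Rs\<^esub> bs)"
proof -
  \<comment> \<open>The map from \<open>(a, as)\<close> to \<open>a # as\<close> is a ring
    homomorphism, which carries the componentwise product of pairs over to lists.\<close>
  have "(a, as) \<in> carrier (RDirProd R (RDirProd_list Rs))"
    "(b, bs) \<in> carrier (RDirProd R (RDirProd_list Rs))"
    using assms by (simp_all add: RDirProd_carrier)
  from ring_hom_mult[OF RDirProd_list_hom1 this] show ?thesis
    by (simp add: RDirProd_def DirProd_def monoid.defs)
qed

lemma RDirProd_list_carrier_Cons:
  "a # as \<in> carrier (RDirProd_list (R # Rs)) \<longleftrightarrow>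
    a \<in> carrier R \<and> as \<in> carrier (RDirProd_list Rs)"
  by (auto simp: RDirProd_list_carrier)

text \<open>The empty product is the trivial ring; it ends the evaluation of a list coordinate by
  coordinate.\<close>

lemma RDirProd_list_Nil_simps:
  "carrier (RDirProd_list []) = {[]}" "\<zero>\<^bsub>RDirProd_list []\<^esub> = []"
  "[] \<otimes>\<^bsub>RDirProd_list []\<^esub> [] = []"
  by (simp_all add: monoid.defs)

lemmas RDirProd_list_simps =
  RDirProd_list_mult_Cons RDirProd_list_carrier_Cons RDirProd_list_zero' RDirProd_list_Nil_simps

text \<open>Unfolding \<open>RDirProd_list []\<close> would keep the rules above from applying.\<close>

declare RDirProd_list_nil [simp del]

lemma RDirProd_list_cring:
  assumes "\<And>R. R \<in> set Rs \<Longrightarrow> cring R"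
  shows "cring (RDirProd_list Rs)"
proof -
  have "ring (RDirProd_list Rs)"
    using assms by (intro RDirProd_list_is_ring) (simp add: cring.axioms(1))
  moreover have "x \<otimes>\<^bsub>RDirProd_list Rs\<^esub> y = y \<otimes>\<^bsub>RDirProd_list Rs\<^esub> x"
    if "x \<in> carrier (RDirProd_list Rs)" "y \<in> carrier (RDirProd_list Rs)" for x y
    using assms that
  proof (induction Rs arbitrary: x y)
    case (Cons R Rs)
    then show ?case
      by (auto simp: RDirProd_list_carrier RDirProd_list_mult_Cons cring.cring_simprules(14))
  qed (simp add: RDirProd_list_Nil_simps)
  ultimately show ?thesis
    by (simp add: cring_def comm_monoid_def comm_monoid_axioms_def ring.is_monoid)
qed

section \<open>At least three factors\<close>

lemma not_bipartite_three_factors: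
  assumes "\<And>R. R \<in> set (R1 # R2 # R3 # Rs) \<Longrightarrow> cring R"
    and "\<one>\<^bsub>R1\<^esub> \<noteq> \<zero>\<^bsub>R1\<^esub>" "\<one>\<^bsub>R2\<^esub> \<noteq> \<zero>\<^bsub>R2\<^esub>" "\<one>\<^bsub>R3\<^esub> \<noteq> \<zero>\<^bsub>R3\<^esub>"
  shows "\<not> bipartite (with_proj (zero_divisor_graph (RDirProd_list (R1 # R2 # R3 # Rs))))"
proof -
  have cring: "cring R1" "cring R2" "cring R3" "cring (RDirProd_list Rs)"
    using assms(1) by (auto intro: RDirProd_list_cring)
  \<comment> \<open>Padding with this tail carries the three unit vectors into a product with any
    further factors, possibly none.\<close>
  let ?o = "\<zero>\<^bsub>RDirProd_list Rs\<^esub>"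
  show ?thesis
    by (rule not_bipartite_if_triangle[OF RDirProd_list_cring[OF assms(1)],
          where x = "\<one>\<^bsub>R1\<^esub> # \<zero>\<^bsub>R2\<^esub> # \<zero>\<^bsub>R3\<^esub> # ?o" and y = "\<zero>\<^bsub>R1\<^esub> # \<one>\<^bsub>R2\<^esub> # \<zero>\<^bsub>R3\<^esub> # ?o"
            and z = "\<zero>\<^bsub>R1\<^esub> # \<zero>\<^bsub>R2\<^esub> # \<one>\<^bsub>R3\<^esub> # ?o"])
      (use assms(2-4) cring in \<open>simp_all add: RDirProd_list_simps cring.cring_simprules\<close>)
qed

section \<open>Two factors\<close>

context
  fixes R S :: "('a, 'm) ring_scheme"
  assumes cring: "cring R" "cring S"
begin

lemma cring_two_factors: "cring (RDirProd_list [R, S])"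
  using cring by (intro RDirProd_list_cring) auto

lemma not_bipartite_two_factors_left:
  assumes "parcs (zero_divisor_graph R) \<noteq> {}" "\<one>\<^bsub>S\<^esub> \<noteq> \<zero>\<^bsub>S\<^esub>"
  shows "\<not> bipartite (with_proj (zero_divisor_graph (RDirProd_list [R, S])))"
proof -
  from assms(1) obtain a b where "(a, b) \<in> parcs (zero_divisor_graph R)"
    by auto
  then show ?thesis
    by (intro not_bipartite_if_triangle[OF cring_two_factors,
          where x = "[a, \<zero>\<^bsub>S\<^esub>]" and y = "[b, \<zero>\<^bsub>S\<^esub>]" and z = "[\<zero>\<^bsub>R\<^esub>, \<one>\<^bsub>S\<^esub>]"])
      (use assms(2) cring in
        \<open>auto simp: parcs_zero_divisor_graph_iff RDirProd_list_simps cring.cring_simprules\<close>)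
qed

text \<open>Exchanging the factors gives an isomorphic ring but not the same one, so the mirror
  image gets its own triangle.\<close>

lemma not_bipartite_two_factors_right:
  assumes "\<one>\<^bsub>R\<^esub> \<noteq> \<zero>\<^bsub>R\<^esub>" "parcs (zero_divisor_graph S) \<noteq> {}"
  shows "\<not> bipartite (with_proj (zero_divisor_graph (RDirProd_list [R, S])))"
proof -
  from assms(2) obtain a b where "(a, b) \<in> parcs (zero_divisor_graph S)"
    by auto
  then show ?thesis
    by (intro not_bipartite_if_triangle[OF cring_two_factors,
          where x = "[\<zero>\<^bsub>R\<^esub>, a]" and y = "[\<zero>\<^bsub>R\<^esub>, b]" and z = "[\<one>\<^bsub>R\<^esub>, \<zero>\<^bsub>S\<^esub>]"])
      (use assms(1) cring in
        \<open>auto simp: parcs_zero_divisor_graph_iff RDirProd_list_simps cring.cring_simprules\<close>)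
qed

text \<open>In each of the three products, every coordinate has a zero factor or is the square of
  \<open>a\<close> or \<open>b\<close>.\<close>

lemma not_bipartite_two_factors_square_zero:
  assumes "a \<in> carrier R" "a \<noteq> \<zero>\<^bsub>R\<^esub>" "a \<otimes>\<^bsub>R\<^esub> a = \<zero>\<^bsub>R\<^esub>"
    and "b \<in> carrier S" "b \<noteq> \<zero>\<^bsub>S\<^esub>" "b \<otimes>\<^bsub>S\<^esub> b = \<zero>\<^bsub>S\<^esub>"
  shows "\<not> bipartite (with_proj (zero_divisor_graph (RDirProd_list [R, S])))"
  by (rule not_bipartite_if_triangle[OF cring_two_factors,
        where x = "[a, \<zero>\<^bsub>S\<^esub>]" and y = "[\<zero>\<^bsub>R\<^esub>, b]" and z = "[a, b]"])
    (use assms cring in \<open>auto simp: RDirProd_list_simps cring.cring_simprules\<close>)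

lemma parcs_two_factorsE:
  assumes "(u, v) \<in> parcs (zero_divisor_graph (RDirProd_list [R, S]))"
  obtains a b c d where "u = [a, b]" "v = [c, d]" "[a, b] \<noteq> [c, d]"
    "[a, b] \<noteq> [\<zero>\<^bsub>R\<^esub>, \<zero>\<^bsub>S\<^esub>]" "[c, d] \<noteq> [\<zero>\<^bsub>R\<^esub>, \<zero>\<^bsub>S\<^esub>]"
    "a \<in> carrier R" "b \<in> carrier S" "c \<in> carrier R" "d \<in> carrier S"
    "a \<otimes>\<^bsub>R\<^esub> c = \<zero>\<^bsub>R\<^esub>" "b \<otimes>\<^bsub>S\<^esub> d = \<zero>\<^bsub>S\<^esub>"
proof -
  have uv: "u \<in> carrier (RDirProd_list [R, S])" "v \<in> carrier (RDirProd_list [R, S])"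
    using assms by (simp_all add: parcs_zero_divisor_graph_iff[OF cring_two_factors])
  then obtain a b c d where eq: "u = [a, b]" "v = [c, d]"
    by (auto simp: RDirProd_list_carrier RDirProd_list_Nil_simps)
  with uv have "a \<in> carrier R" "b \<in> carrier S" "c \<in> carrier R" "d \<in> carrier S"
    by (simp_all add: RDirProd_list_simps)
  with assms show thesis
    unfolding eq
    by (intro that[OF eq])
      (simp_all add: parcs_zero_divisor_graph_iff[OF cring_two_factors] RDirProd_list_simps)
qed

text \<open>For an edge from \<open>[a, b]\<close> to \<open>[c, d]\<close>, the domain forces
  \<open>a\<close> or \<open>c\<close> to vanish. If both did, \<open>b\<close> and \<open>d\<close>
  would be nonzero and distinct with product zero, hence an edge for \<open>S\<close>.\<close>

lemma bipartite_two_factors_domain_left: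
  assumes "domain R" "parcs (zero_divisor_graph S) = {}"
  shows "bipartite (with_proj (zero_divisor_graph (RDirProd_list [R, S])))"
proof (rule bipartite_zero_divisor_graphI[OF cring_two_factors, where P = "\<lambda>v. v ! 0 = \<zero>\<^bsub>R\<^esub>"])
  fix u v assume "(u, v) \<in> parcs (zero_divisor_graph (RDirProd_list [R, S]))"
  moreover have "(b, d) \<notin> parcs (zero_divisor_graph S)" for b d
    using assms(2) by simp
  ultimately show "u ! 0 = \<zero>\<^bsub>R\<^esub> \<longleftrightarrow> v ! 0 \<noteq> \<zero>\<^bsub>R\<^esub>"
    using domain.integral[OF assms(1)]
    by (elim parcs_two_factorsE) (auto simp: parcs_zero_divisor_graph_iff[OF cring(2)])
qed

lemma bipartite_two_factors_domain_right:
  assumes "parcs (zero_divisor_graph R) = {}" "domain S"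
  shows "bipartite (with_proj (zero_divisor_graph (RDirProd_list [R, S])))"
proof (rule bipartite_zero_divisor_graphI[OF cring_two_factors, where P = "\<lambda>v. v ! 1 = \<zero>\<^bsub>S\<^esub>"])
  fix u v assume "(u, v) \<in> parcs (zero_divisor_graph (RDirProd_list [R, S]))"
  moreover have "(a, c) \<notin> parcs (zero_divisor_graph R)" for a c
    using assms(1) by simp
  ultimately show "u ! 1 = \<zero>\<^bsub>S\<^esub> \<longleftrightarrow> v ! 1 \<noteq> \<zero>\<^bsub>S\<^esub>"
    using domain.integral[OF assms(2)]
    by (elim parcs_two_factorsE) (auto simp: parcs_zero_divisor_graph_iff[OF cring(1)])
qed

end

section \<open>Residue rings\<close>

lemma residue_ring_cring: "m \<ge> 2 \<Longrightarrow> cring (residue_ring m)" for m :: int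
  by (intro residues.cring) (simp add: residues_def)

lemma residue_ring_domain:
  fixes m :: int
  assumes "prime m"
  shows "domain (residue_ring m)"
proof -
  \<comment> \<open>\<open>residues_prime\<close> takes a natural number, so the integer modulus
    passes through \<open>nat\<close>.\<close>
  have "int (nat m) = m"
    using assms by (simp add: prime_ge_0_int)
  have "residues_prime (nat m)"
    by (rule residues_prime.intro) (use assms in \<open>simp only: prime_int_nat_transfer\<close>)
  from field.axioms(1)[OF residues_prime.is_field[OF this]] show ?thesis
    unfolding \<open>int (nat m) = m\<close> .
qed

lemma residue_ring_carrier: "x \<in> carrier (residue_ring m) \<longleftrightarrow> 0 \<le> x \<and> x < m"
  by (auto simp: residue_ring_def)

lemma residue_ring_simps:
  "\<zero>\<^bsub>residue_ring m\<^esub> = 0" "\<one>\<^bsub>residue_ring m\<^esub> = 1"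
  "x \<otimes>\<^bsub>residue_ring m\<^esub> y = x * y mod m"
  by (simp_all add: residue_ring_def)

lemma zero_divisor_graph_residue_ring_edgeless_iff:
  fixes m :: int
  assumes "m \<ge> 2"
  shows "parcs (zero_divisor_graph (residue_ring m)) = {} \<longleftrightarrow> prime m \<or> m = 4"
proof
  assume edgeless: "parcs (zero_divisor_graph (residue_ring m)) = {}"
  have no_edge: False if "0 < x" "x < m" "0 < y" "y < m" "x \<noteq> y" "m dvd x * y" for x y
  proof -
    have "(x, y) \<in> parcs (zero_divisor_graph (residue_ring m))"
      using that assms
      by (simp add: parcs_zero_divisor_graph_iff residue_ring_cring residue_ring_carrier
          residue_ring_simps)
    with edgeless show False by simp
  qed
  show "prime m \<or> m = 4"
  proof (rule disjCI)
    assume "m \<noteq> 4"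
    show "prime m"
    proof (rule ccontr)
      assume "\<not> prime m"
      then obtain d where "d \<ge> 0" "d dvd m" "d \<noteq> 1" "d \<noteq> m"
        using assms unfolding prime_int_iff by auto
      moreover from this have "d \<noteq> 0" "d \<le> m"
        using assms by (auto dest: zdvd_imp_le)
      ultimately have d: "d dvd m" "1 < d" "d < m"
        by auto
      then obtain e where m: "m = d * e" by (elim dvdE)
      have "0 < e"
        using d assms m zero_less_mult_pos[of d e] by simp
      moreover from this have "e < m"
        using d m by simp
      ultimately have e: "1 < e" "e < m"
        using d m by (cases "e = 1"; simp)+
      show False
      proof (cases "d = e")
        case False
        then show False using no_edge[of d e] d e m by auto
      next
        case True
        with \<open>m \<noteq> 4\<close> m have "d \<noteq> 2" by auto
        \<comment> \<open>Now \<open>m = d * d\<close> with \<open>d > 2\<close>, so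
          \<open>2 * d\<close> lies below \<open>m\<close>, while \<open>d * (2 * d)\<close> is
          \<open>2 * m\<close>.\<close>
        with d have "2 * d < m" using True m by simp
        then show False using no_edge[of d "2 * d"] d m True by auto
      qed
    qed
  qed
next
  assume "prime m \<or> m = 4"
  then show "parcs (zero_divisor_graph (residue_ring m)) = {}"
  proof
    assume "prime m"
    with assms show ?thesis
      by (auto simp: parcs_zero_divisor_graph_iff residue_ring_cring
          dest: domain.integral[OF residue_ring_domain])
  next
    assume m: "m = 4"
    have "(x, y) \<notin> parcs (zero_divisor_graph (residue_ring m))" for x y
    proof
      assume "(x, y) \<in> parcs (zero_divisor_graph (residue_ring m))"
      then have xy: "0 \<le> x" "x < 4" "x \<noteq> 0" "0 \<le> y" "y < 4" "y \<noteq> 0" "x \<noteq> y" "x * y mod 4 = 0"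
        using assms m by (simp_all add: parcs_zero_divisor_graph_iff residue_ring_cring
            residue_ring_carrier residue_ring_simps)
      \<comment> \<open>Among products of 1, 2 and 3 only \<open>2 * 2\<close> vanishes modulo 4,
        and this one has equal factors.\<close>
      then have "x = 1 \<or> x = 2 \<or> x = 3" "y = 1 \<or> y = 2 \<or> y = 3"
        by linarith+
      with xy show False by (elim disjE) simp_all
    qed
    then show ?thesis by auto
  qed
qed

theorem theorem3p3:
  fixes k :: nat and n :: "nat \<Rightarrow> int"
  assumes "k \<ge> 2"
    and "\<And>i. i \<in> {1..k} \<Longrightarrow> n i \<ge> 2"
  shows "bipartite (with_proj (zero_divisor_graph
           (RDirProd_list (map (\<lambda>i. residue_ring (n i)) [1..<Suc k]))))
         \<longleftrightarrow> k = 2 \<and> ((prime (n 1) \<and> prime (n 2))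
                   \<or> (prime (n 1) \<and> n 2 = 4) \<or> (n 1 = 4 \<and> prime (n 2)))"
proof (cases "k = 2")
  case True
  let ?R = "residue_ring (n 1)" and ?S = "residue_ring (n 2)"
  have ge: "n 1 \<ge> 2" "n 2 \<ge> 2" using assms True by auto
  note cring = ge[THEN residue_ring_cring]
  have "[1..<Suc k] = [1, 2]"
    using True by (simp add: upt_rec numeral_eq_Suc)
  then have list: "map (\<lambda>i. residue_ring (n i)) [1..<Suc k] = [?R, ?S]"
    by (simp only: list.map)
  note edgeless = ge[THEN zero_divisor_graph_residue_ring_edgeless_iff]
  show ?thesis
    unfolding list
  proof
    assume bip: "bipartite (with_proj (zero_divisor_graph (RDirProd_list [?R, ?S])))"
    have one: "\<one>\<^bsub>?R\<^esub> \<noteq> \<zero>\<^bsub>?R\<^esub>" "\<one>\<^bsub>?S\<^esub> \<noteq> \<zero>\<^bsub>?S\<^esub>"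
      by (simp_all only: residue_ring_simps one_neq_zero not_False_eq_True)
    have "prime (n 1) \<or> n 1 = 4"
      using bip not_bipartite_two_factors_left[OF cring _ one(2)] edgeless(1) by blast
    moreover have "prime (n 2) \<or> n 2 = 4"
      using bip not_bipartite_two_factors_right[OF cring one(1)] edgeless(2) by blast
    moreover have "\<not> (n 1 = 4 \<and> n 2 = 4)"
    proof
      assume "n 1 = 4 \<and> n 2 = 4"
      then have "\<not> bipartite (with_proj (zero_divisor_graph (RDirProd_list [?R, ?S])))"
        by (intro not_bipartite_two_factors_square_zero[OF cring, of 2 2])
          (simp_all add: residue_ring_simps residue_ring_carrier)
      with bip show False by contradiction
    qed
    ultimately show "k = 2 \<and> ((prime (n 1) \<and> prime (n 2))
        \<or> (prime (n 1) \<and> n 2 = 4) \<or> (n 1 = 4 \<and> prime (n 2)))"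
      using True by blast
  next
    assume "k = 2 \<and> ((prime (n 1) \<and> prime (n 2))
        \<or> (prime (n 1) \<and> n 2 = 4) \<or> (n 1 = 4 \<and> prime (n 2)))"
    \<comment> \<open>In each of the three alternatives one modulus is prime and the other is prime
      or 4, which is to say edgeless.\<close>
    then consider "prime (n 1)" "parcs (zero_divisor_graph ?S) = {}"
      | "parcs (zero_divisor_graph ?R) = {}" "prime (n 2)"
      using edgeless by blast
    then show "bipartite (with_proj (zero_divisor_graph (RDirProd_list [?R, ?S])))"
    proof cases
      case 1
      then show ?thesis
        by (intro bipartite_two_factors_domain_left[OF cring] residue_ring_domain)
    next
      case 2
      then show ?thesis
        by (intro bipartite_two_factors_domain_right[OF cring] residue_ring_domain)
    qed
  qed
next
  case False
  \<comment> \<open>Here \<open>k\<close> is at least 3. The first three factors are exposed at the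
    front; the remaining list is empty when \<open>k = 3\<close>.\<close>
  with assms(1) have upt: "[1..<Suc k] = 1 # 2 # 3 # [4..<Suc k]"
    by (simp add: upt_conv_Cons numeral_eq_Suc del: upt_Suc)
  have "cring R" if "R \<in> set (map (\<lambda>i. residue_ring (n i)) [1..<Suc k])" for R
  proof -
    from that obtain i where "R = residue_ring (n i)" "i \<in> {1..k}"
      by (auto simp del: upt_Suc)
    then show ?thesis
      using assms(2) residue_ring_cring by blast
  qed
  then have "\<not> bipartite (with_proj (zero_divisor_graph
      (RDirProd_list (map (\<lambda>i. residue_ring (n i)) [1..<Suc k]))))"
    unfolding upt list.map by (rule not_bipartite_three_factors) (simp_all add: residue_ring_simps)
  with False show ?thesis by blast
qed

end
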